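(* Let $P\subset\mathbb{R}^n$ be a lattice polytope of dimension $d$ (not necessarily simple). (a) If the lattice length of every edge of $P$ is at least $2d^2(d+1)$, then $P$ is integrally closed. (b) If $P$ is a simplex and the lattice length of every edge of $P$ is at least $d(d+1)$, then $P$ is covered by lattice parallelepipeds, i.e. $P$ is the union of the lattice parallelepipeds contained in $P$. In particular, $P$ is integrally closed.
   Context: A lattice polytope is a polytope all of whose vertices lie in $\mathbb{Z}^n$. The lattice length of a rational segment $[x,y]$ is the ratio of its Euclidean length to the Euclidean length of the primitive integer vector (integer vector with coprime coordinates) in the direction of $y-x$. A lattice polytope $P\subset\mathbb{R}^n$ is integrally closed if for every $c\in\mathbb{N}$ and every $z\in cP\cap\mathbb{Z}^n$ there exist $x_1,\dots,x_c\in P\cap\mathbb{Z}^n$ with $x_1+\cdots+x_c=z$. A parallelepiped is a Minkowski sum of segments with linearly independent directions; a lattice parallelepiped is one whose vertices all lie in $\mathbb{Z}^n$. *)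

theory Defs
  imports "HOL-Analysis.Analysis"
begin

definition int_lattice :: "(real ^ 'n) set" where
  "int_lattice = {x. \<forall>i. x $ i \<in> \<int>}"

definition lattice_polytope :: "(real ^ 'n) set \<Rightarrow> bool" where
  "lattice_polytope P \<longleftrightarrow> polytope P \<and> {v. v extreme_point_of P} \<subseteq> int_lattice"

definition primitive_vector :: "real ^ 'n \<Rightarrow> bool" where
  "primitive_vector u \<longleftrightarrow>
     (\<exists>w :: int ^ 'n. Gcd (range (\<lambda>i. w $ i)) = 1 \<and> u = (\<chi> i. of_int (w $ i)))"

text \<open>The description below is meaningful only for nondegenerate segments of rational direction,
  such as the edges of a lattice polytope.\<close>

definition primitive_direction :: "real ^ 'n \<Rightarrow> real ^ 'n \<Rightarrow> real ^ 'n" where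
  "primitive_direction x y =
     (THE u. primitive_vector u \<and> (\<exists>t>0. y - x = t *\<^sub>R u))"

definition lattice_length :: "real ^ 'n \<Rightarrow> real ^ 'n \<Rightarrow> real" where
  "lattice_length x y = norm (y - x) / norm (primitive_direction x y)"

definition integrally_closed :: "(real ^ 'n) set \<Rightarrow> bool" where
  "integrally_closed P \<longleftrightarrow>
     (\<forall>c :: nat. \<forall>z \<in> ((\<lambda>x. real c *\<^sub>R x) ` P) \<inter> int_lattice.
        \<exists>x :: nat \<Rightarrow> real ^ 'n.
          (\<forall>i \<in> {1..c}. x i \<in> P \<inter> int_lattice) \<and> (\<Sum>i = 1..c. x i) = z)"

text \<open>The sum over sets is the Minkowski sum. The translation by \<open>p\<close> can be absorbed into
  a segment when \<open>k > 0\<close>; for \<open>k = 0\<close> it makes every single point a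
  0-dimensional parallelepiped.\<close>

definition parallelepiped :: "(real ^ 'n) set \<Rightarrow> bool" where
  "parallelepiped Q \<longleftrightarrow>
     (\<exists>(k :: nat) p a b.
        inj_on (\<lambda>i. b i - a i) {..<k} \<and>
        independent ((\<lambda>i. b i - a i) ` {..<k}) \<and>
        Q = {p} + (\<Sum>i<k. closed_segment (a i) (b i)))"

definition lattice_parallelepiped :: "(real ^ 'n) set \<Rightarrow> bool" where
  "lattice_parallelepiped Q \<longleftrightarrow>
     parallelepiped Q \<and> {v. v extreme_point_of Q} \<subseteq> int_lattice"

end

theory Submission
  imports Defs
begin

text \<open>
  A convex \<open>P\<close> is integrally closed as soon as every \<open>u \<in> P\<close> has a lattice point \<open>y \<in> P\<close>
  with \<open>2u - y \<in> P\<close>: from \<open>z = cu\<close> one splits off \<open>y\<close>, and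
  \<open>z - y = (c - 2)u + (2u - y)\<close> lies in \<open>(c - 1)P\<close>.

  Some vertex \<open>v\<close> has weight at least \<open>1/(d + 1)\<close> in \<open>u\<close>, so from \<open>u\<close> one can move inside \<open>P\<close>
  along every edge direction at \<open>v\<close> by at least \<open>1/(d + 1)\<close> of the length of that edge.

  For a simplex, rounding down the coordinates of \<open>u\<close> with respect to the primitive edge vectors
  at \<open>v\<close> gives the corner of a unit parallelepiped that contains \<open>u\<close> and lies in \<open>P\<close>.

  For a general polytope one proves by induction on \<open>d\<close> the asymmetric statement
  \<open>(1 + \<beta>)u = y + \<beta>x\<close> with \<open>x \<in> P\<close>, where \<open>\<beta>\<^sup>2\<close> may be as small as a constant times
  \<open>d\<^sup>3\<close> divided by the edge length. Choose a basis of primitive edge vectors \<open>e\<close> at \<open>v\<close>. If one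
  can move from \<open>u\<close> by \<open>d/(2\<beta>)\<close> in every direction \<open>-e\<close>, round \<open>u\<close> to the nearest point of
  \<open>v + \<Sum> \<int>e\<close>. Otherwise \<open>u = (1 - \<tau>)u' + \<tau>q\<close> with \<open>u'\<close> in a facet, \<open>q \<in> P\<close> and \<open>\<tau>\<close>
  small, and the induction hypothesis for \<open>u'\<close> and \<open>\<beta> - \<tau>(1 + \<beta>)\<close> gives \<open>y\<close> in that facet.
\<close>

section \<open>Lattice points and integral closedness\<close>

lemma int_lattice_add: "x \<in> int_lattice \<Longrightarrow> y \<in> int_lattice \<Longrightarrow> x + y \<in> int_lattice"
  by (simp add: int_lattice_def)

lemma int_lattice_diff: "x \<in> int_lattice \<Longrightarrow> y \<in> int_lattice \<Longrightarrow> x - y \<in> int_lattice"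
  by (simp add: int_lattice_def)

lemma int_lattice_scale_int: "x \<in> int_lattice \<Longrightarrow> of_int k *\<^sub>R x \<in> int_lattice"
  by (simp add: int_lattice_def)

lemma int_lattice_zero: "0 \<in> int_lattice"
  by (simp add: int_lattice_def)

lemma int_lattice_sum: "(\<And>i. i \<in> A \<Longrightarrow> f i \<in> int_lattice) \<Longrightarrow> sum f A \<in> int_lattice"
  by (induction A rule: infinite_finite_induct) (auto simp: int_lattice_add int_lattice_zero)

lemma integrally_closedI:
  fixes P :: "(real ^ 'n) set"
  assumes "convex P"
    and split: "\<And>u. u \<in> P \<Longrightarrow> \<exists>y \<in> P \<inter> int_lattice. 2 *\<^sub>R u - y \<in> P"
  shows "integrally_closed P"
proof -
  have "\<exists>x. (\<forall>i \<in> {1..c}. x i \<in> P \<inter> int_lattice) \<and> (\<Sum>i = 1..c. x i) = z"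
    if "u \<in> P" "z = real c *\<^sub>R u" "z \<in> int_lattice" for c u z
    using that
  proof (induction c arbitrary: u z)
    case 0
    then show ?case by simp
  next
    case (Suc c)
    show ?case
    proof (cases "c = 0")
      case True
      with Suc.prems show ?thesis
        by (intro exI[of _ "\<lambda>_. z"]) auto
    next
      case False
      obtain y where y: "y \<in> P" "y \<in> int_lattice" "2 *\<^sub>R u - y \<in> P"
        using split[OF Suc.prems(1)] by blast
      define w where "w = ((real c - 1) / real c) *\<^sub>R u + (1 / real c) *\<^sub>R (2 *\<^sub>R u - y)"
      have "w \<in> P"
        unfolding w_def using False y Suc.prems
        by (intro convexD[OF \<open>convex P\<close>]) (auto simp: field_simps)
      moreover have "z - y = real c *\<^sub>R w"
        using False Suc.prems unfolding w_def
        by (simp add: scaleR_add_right scaleR_2) (simp add: algebra_simps)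
      moreover have "z - y \<in> int_lattice"
        using Suc.prems y by (simp add: int_lattice_diff)
      ultimately obtain x where x: "\<forall>i \<in> {1..c}. x i \<in> P \<inter> int_lattice" "(\<Sum>i = 1..c. x i) = z - y"
        using Suc.IH by blast
      have "(\<Sum>i = 1..c. (x(Suc c := y)) i) = (\<Sum>i = 1..c. x i)"
        by (rule sum.cong) auto
      then show ?thesis
        using x y by (intro exI[of _ "x(Suc c := y)"]) (auto simp: le_Suc_eq)
    qed
  qed
  then show ?thesis
    unfolding integrally_closed_def by blast
qed

section \<open>Vertices and edges of polytopes\<close>

lemma convex_add_sum_mem:
  fixes P :: "'a::real_vector set"
  assumes "convex P" "u \<in> P" "finite B" "card B \<le> d" "0 < d"
    and g: "\<And>b. b \<in> B \<Longrightarrow> u + real d *\<^sub>R g b \<in> P"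
  shows "u + sum g B \<in> P"
proof (cases "B = {}")
  case False
  define k where "k = card B"
  have k: "0 < k" "k \<le> d"
    using False assms unfolding k_def by (auto simp: card_gt_0_iff)
  have "u + real k *\<^sub>R g b \<in> P" if "b \<in> B" for b
  proof -
    have "(1 - real k / real d) *\<^sub>R u + (real k / real d) *\<^sub>R (u + real d *\<^sub>R g b) \<in> P"
      using k assms g[OF that] by (intro convexD[OF \<open>convex P\<close>]) (auto simp: field_simps)
    moreover have "(1 - real k / real d) *\<^sub>R u + (real k / real d) *\<^sub>R (u + real d *\<^sub>R g b)
        = u + real k *\<^sub>R g b"
      using k by (simp add: algebra_simps)
    ultimately show ?thesis by simp
  qed
  then have "(\<Sum>b\<in>B. (1 / real k) *\<^sub>R (u + real k *\<^sub>R g b)) \<in> P"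
    using assms k by (intro convex_sum) (auto simp: k_def)
  also have "(\<Sum>b\<in>B. (1 / real k) *\<^sub>R (u + real k *\<^sub>R g b)) = (\<Sum>b\<in>B. (1 / real k) *\<^sub>R u + g b)"
    using k by (intro sum.cong) (auto simp: algebra_simps)
  also have "\<dots> = u + sum g B"
    using k by (simp add: sum.distrib k_def sum_constant_scaleR)
  finally show ?thesis .
qed (use assms in auto)

lemma polytope_vertex_weight:
  fixes P :: "'a::euclidean_space set"
  assumes "polytope P" "aff_dim P = int d" "u \<in> P"
  obtains v q t where "v extreme_point_of P" "q \<in> P" "1 / (real d + 1) \<le> t" "t \<le> 1"
    "u = t *\<^sub>R v + (1 - t) *\<^sub>R q"
proof -
  have P: "P = convex hull {x. x extreme_point_of P}" (is "P = convex hull ?V")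
    using assms polytope_imp_compact polytope_imp_convex Krein_Milman_Minkowski by blast
  have "aff_dim ?V = int d"
    using assms(2) P aff_dim_convex_hull by metis
  moreover have "u \<in> convex hull ?V"
    using P assms by simp
  ultimately obtain S c where S: "finite S" "S \<subseteq> ?V" "int (card S) \<le> int d + 1"
      "\<forall>x\<in>S. 0 \<le> c x" "sum c S = 1" "(\<Sum>v\<in>S. c v *\<^sub>R v) = u"
    unfolding convex_hull_caratheodory_aff_dim[of ?V] by auto
  have "\<exists>v\<in>S. 1 / (real d + 1) \<le> c v"
  proof (rule ccontr)
    assume "\<not> ?thesis"
    then have lt: "\<forall>v\<in>S. c v < 1 / (real d + 1)" by auto
    have "S \<noteq> {}" using S by auto
    then have "sum c S < (\<Sum>v\<in>S. 1 / (real d + 1))"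
      using lt S by (intro sum_strict_mono) auto
    also have "\<dots> = real (card S) / (real d + 1)" by simp
    also have "\<dots> \<le> 1" using S(3) by (simp add: field_simps)
    finally show False using S by simp
  qed
  then obtain v where v: "v \<in> S" "1 / (real d + 1) \<le> c v" by auto
  have split: "c v + sum c (S - {v}) = 1" "u = c v *\<^sub>R v + (\<Sum>w\<in>S - {v}. c w *\<^sub>R w)"
    using S v by (auto simp: sum.remove)
  have nn: "0 \<le> sum c (S - {v})" using S by (intro sum_nonneg) auto
  have SP: "S \<subseteq> P" using S by (auto simp: extreme_point_of_def)
  have "\<exists>q\<in>P. (\<Sum>w\<in>S - {v}. c w *\<^sub>R w) = (1 - c v) *\<^sub>R q"
  proof (cases "c v = 1")
    case True
    then have "\<forall>w\<in>S - {v}. c w = 0"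
      using split S by (subst sum_nonneg_eq_0_iff[symmetric]) auto
    then show ?thesis using True assms(3) by (intro bexI[of _ u]) auto
  next
    case False
    then have pos: "1 - c v > 0" using split nn by linarith
    have "(\<Sum>w\<in>S - {v}. (c w / (1 - c v)) *\<^sub>R w) \<in> P"
      using S SP pos split assms polytope_imp_convex
      by (intro convex_sum) (auto simp flip: sum_divide_distrib)
    then show ?thesis using pos
      by (intro bexI) (auto simp: scaleR_sum_right)
  qed
  then obtain q where "q \<in> P" "u = c v *\<^sub>R v + (1 - c v) *\<^sub>R q"
    using split by auto
  moreover have "c v \<le> 1" using split nn by linarith
  moreover have "v extreme_point_of P" using S v by auto
  ultimately show ?thesis using that v by blast
qed

lemma edge_endpoint_extreme_point:
  assumes "closed_segment v w edge_of P"
  shows "v extreme_point_of P" "w extreme_point_of P"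
proof -
  have "closed_segment v w face_of P" using assms edge_of_def by blast
  then show "v extreme_point_of P" "w extreme_point_of P"
    using extreme_point_of_face extreme_point_of_segment by blast+
qed

lemma edge_of_face:
  assumes "E edge_of F" "F face_of P"
  shows "E edge_of P"
  using assms face_of_trans unfolding edge_of_def by blast

lemma polytope_subset_span_edges:
  fixes P :: "'a::euclidean_space set"
  assumes "polytope P" "v extreme_point_of P" "p \<in> P"
  shows "p - v \<in> span {w - v | w. closed_segment v w edge_of P}"
  using assms
proof (induction "nat (aff_dim P)" arbitrary: P p rule: less_induct)
  case less
  let ?S = "\<lambda>P. span {w - v | w. closed_segment v w edge_of P}"
  have vP: "v \<in> P" using less.prems by (simp add: extreme_point_of_def)
  consider "aff_dim P = 0" | "aff_dim P = 1" | "aff_dim P \<ge> 2"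
    using aff_dim_negative_iff[of P] vP by (metis add_0 empty_iff linorder_not_less one_add_one order_le_less zless_imp_add1_zle)
  then show ?case
  proof cases
    case 1
    then have "p = v" using vP less.prems by (auto simp: aff_dim_eq_0)
    then show ?thesis by (simp add: span_zero)
  next
    case 2
    then obtain a b where ab: "P = closed_segment a b"
      using less.prems compact_convex_collinear_segment vP
      by (metis collinear_aff_dim empty_iff order_refl polytope_imp_compact polytope_imp_convex)
    have "v = a \<or> v = b"
      using less.prems ab extreme_point_of_segment by blast
    then obtain w where w: "P = closed_segment v w"
      using ab closed_segment_commute by metis
    then have "closed_segment v w edge_of P"
      using 2 by (simp add: edge_of_def face_of_refl)
    then have "w - v \<in> ?S P" by (intro span_base) blast
    moreover obtain t where "p = (1 - t) *\<^sub>R v + t *\<^sub>R w"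
      using less.prems w by (auto simp: in_segment)
    then have "p - v = t *\<^sub>R (w - v)" by (simp add: algebra_simps)
    ultimately show ?thesis by (simp add: span_scale)
  next
    case 3
    have poly: "polyhedron P" using less.prems polytope_imp_polyhedron by blast
    have facet: "x - v \<in> ?S P" if "F facet_of P" "v \<in> F" "x \<in> F" for F x
    proof -
      have F: "F face_of P" "aff_dim F = aff_dim P - 1"
        using that by (auto simp: facet_of_def)
      have "v extreme_point_of F"
        using less.prems F that extreme_point_of_face by blast
      then have "x - v \<in> ?S F"
        using less.hyps[of F] F that 3 less.prems face_of_polytope_polytope by auto
      moreover have "?S F \<subseteq> ?S P"
        using F edge_of_face by (intro span_mono) blast
      ultimately show ?thesis by blast
    qed
    have "{v} face_of P" "{v} \<noteq> P"
      using less.prems 3 by (auto simp: face_of_singleton)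
    then have inter: "{v} = \<Inter>{F. F facet_of P \<and> {v} \<subseteq> F}"
      using face_of_polyhedron[OF poly] by blast
    obtain F where F: "F facet_of P" "v \<in> F"
      using face_of_polyhedron_subset_facet[OF poly \<open>{v} face_of P\<close> _ \<open>{v} \<noteq> P\<close>] by blast
    have "F \<noteq> {v}" using F 3 by (auto simp: facet_of_def)
    then obtain G where G: "G facet_of P" "v \<in> G" "G \<noteq> F"
    proof -
      have "\<exists>G. G facet_of P \<and> v \<in> G \<and> G \<noteq> F"
      proof (rule ccontr)
        assume "\<not> ?thesis"
        then have "F \<subseteq> \<Inter>{F. F facet_of P \<and> {v} \<subseteq> F}" by blast
        then have "F \<subseteq> {v}" by (subst inter)
        then show False using \<open>F \<noteq> {v}\<close> F(2) by blast
      qed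
      then show ?thesis using that by blast
    qed
    have Fface: "F face_of P" "G face_of P" using F G facet_of_imp_face_of by auto
    \<comment> \<open>Two distinct facets through \<open>v\<close> already span all directions of \<open>P\<close>.\<close>
    have "\<not> G \<subseteq> affine hull F"
    proof
      assume "G \<subseteq> affine hull F"
      then have "G \<subseteq> F"
        using face_of_imp_eq_affine_Int[of P F] Fface less.prems face_of_imp_subset polytope_imp_convex by blast
      then have "G face_of F" using Fface face_of_face by blast
      moreover have "convex F" "aff_dim G = aff_dim F"
        using F(1) G(1) face_of_imp_convex by (auto simp: facet_of_def)
      ultimately show False
        using G(3) face_of_aff_dim_lt[of F G] by simp
    qed
    then obtain g where g: "g \<in> G" "g \<notin> affine hull F" by auto
    let ?D = "\<lambda>X. (\<lambda>x. x - v) ` X"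
    have eq: "affine hull F = (\<lambda>x. v + x) ` span (?D F)"
      using affine_hull_insert_span_gen[of v F] F by (simp add: insert_absorb)
    have "g - v \<notin> span (?D F)"
      using g eq by (metis add.commute diff_add_cancel image_eqI)
    then have "span (?D F) \<subset> ?S P"
      using facet[OF F] facet[OF G(1,2) g(1)]
      by (metis (no_types, lifting) image_subsetI psubsetI span_minimal subspace_span)
    then have "dim (span (?D F)) < dim (?S P)"
      by (intro dim_psubset) (simp add: span_span)
    moreover have "aff_dim F = int (dim (?D F))"
      by (intro aff_dim_eq_dim_subtract hull_inc) (rule F(2))
    moreover have "aff_dim P = int (dim (?D P))"
      by (intro aff_dim_eq_dim_subtract hull_inc) (rule vP)
    moreover have "aff_dim F = aff_dim P - 1" using F by (simp add: facet_of_def)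
    ultimately have "dim (?D P) \<le> dim (?S P)" by simp
    moreover have "{w - v | w. closed_segment v w edge_of P} \<subseteq> ?D P"
    proof clarify
      fix w assume "closed_segment v w edge_of P"
      then have "w \<in> P" using edge_of_imp_subset ends_in_segment(2) by blast
      then show "w - v \<in> ?D P" by blast
    qed
    then have "?S P \<subseteq> span (?D P)" by (rule span_mono)
    ultimately have "?S P = span (?D P)"
      by (intro subspace_dim_equal) (simp_all add: subspace_span dim_span)
    moreover have "p - v \<in> span (?D P)" using less.prems(3) by (intro span_base) blast
    ultimately show ?thesis by simp
  qed
qed

section \<open>Lattice length\<close>

lemma primitive_multiple_eq_Gcd:
  fixes w z :: "int ^ 'n"
  assumes "Gcd (range (\<lambda>i. w $ i)) = 1" "t > 0" "\<And>i. t * real_of_int (w $ i) = real_of_int (z $ i)"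
  shows "t = real_of_int (Gcd (range (\<lambda>i. z $ i)))"
proof -
  have "\<exists>j. w $ j \<noteq> 0"
  proof (rule ccontr)
    assume "\<not> ?thesis"
    then have "range (\<lambda>i. w $ i) \<subseteq> {0}" by auto
    then show False using assms(1) by (simp add: Gcd_0_iff[symmetric])
  qed
  then obtain j where j: "w $ j \<noteq> 0" by blast
  then have "t = real_of_int (z $ j) / real_of_int (w $ j)"
    using assms(3)[of j] by (simp add: field_simps)
  then have "t \<in> \<rat>" by simp
  then obtain a b :: int where ab: "b > 0" "coprime a b" "t = real_of_int a / real_of_int b"
    by (metis Rats_cases')
  have eq: "a * w $ i = b * z $ i" for i
  proof -
    have "real_of_int (a * w $ i) = real_of_int (b * z $ i)"
      using assms(3)[of i] ab by (simp add: field_simps)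
    then show ?thesis by (simp only: of_int_eq_iff)
  qed
  have "b dvd w $ i" for i
  proof -
    have "b dvd a * w $ i" using eq by simp
    then show ?thesis using ab(2) by (simp add: coprime_commute coprime_dvd_mult_right_iff)
  qed
  then have "b dvd Gcd (range (\<lambda>i. w $ i))" by (intro Gcd_greatest) auto
  then have b: "b = 1" using assms(1) ab(1) by simp
  then have "z $ i = a * w $ i" for i using eq[of i] by simp
  then have "range (\<lambda>i. z $ i) = (*) a ` range (\<lambda>i. w $ i)"
    by (auto simp: image_image)
  then have "Gcd (range (\<lambda>i. z $ i)) = normalize (a * Gcd (range (\<lambda>i. w $ i)))"
    by (simp only: Gcd_mult)
  moreover have "a > 0" using ab b assms(2) by simp
  ultimately show ?thesis using ab b assms(1) by simp
qed

lemma lattice_length_scaleR: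
  fixes x y :: "real ^ 'n"
  assumes "x \<in> int_lattice" "y \<in> int_lattice" "x \<noteq> y"
  obtains e where "e \<in> int_lattice" "y - x = lattice_length x y *\<^sub>R e"
proof -
  define z :: "int ^ 'n" where "z = (\<chi> i. \<lfloor>(y - x) $ i\<rfloor>)"
  have z: "real_of_int (z $ i) = (y - x) $ i" for i
  proof -
    have "(y - x) $ i \<in> \<int>" using int_lattice_diff[OF assms(2,1)] by (simp add: int_lattice_def)
    then obtain k where "(y - x) $ i = of_int k" by (auto elim: Ints_cases)
    then show ?thesis by (simp only: z_def vec_lambda_beta floor_of_int)
  qed
  define g where "g = Gcd (range (\<lambda>i. z $ i))"
  have "\<exists>i. (y - x) $ i \<noteq> 0"
    using assms(3) by (metis right_minus_eq vec_eq_iff zero_index)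
  then obtain i where "z $ i \<noteq> 0" using z by (metis of_int_0)
  then have "\<not> range (\<lambda>i. z $ i) \<subseteq> {0}" by blast
  then have "g \<noteq> 0" unfolding g_def by simp
  moreover have "0 \<le> g" unfolding g_def by simp
  ultimately have g: "g > 0" by simp
  define w :: "int ^ 'n" where "w = (\<chi> i. z $ i div g)"
  have zw: "z $ i = g * w $ i" for i
    unfolding w_def g_def by simp
  then have "range (\<lambda>i. z $ i) = (*) g ` range (\<lambda>i. w $ i)"
    by (auto simp: image_image)
  then have "Gcd (range (\<lambda>i. z $ i)) = Gcd ((*) g ` range (\<lambda>i. w $ i))"
    by (rule arg_cong)
  also have "\<dots> = normalize (g * Gcd (range (\<lambda>i. w $ i)))"
    by (rule Gcd_mult)
  finally have "g = normalize (g * Gcd (range (\<lambda>i. w $ i)))"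
    by (fold g_def)
  then have w: "Gcd (range (\<lambda>i. w $ i)) = 1"
    using g by (simp add: abs_mult)
  define e :: "real ^ 'n" where "e = (\<chi> i. of_int (w $ i))"
  have e: "primitive_vector e" "y - x = real_of_int g *\<^sub>R e"
    using w z zw by (auto simp: primitive_vector_def e_def vec_eq_iff)
  have "primitive_direction x y = e"
    unfolding primitive_direction_def
  proof (rule the_equality)
    show "primitive_vector e \<and> (\<exists>t>0. y - x = t *\<^sub>R e)"
      using e g by (metis of_int_0_less_iff)
  next
    fix u assume "primitive_vector u \<and> (\<exists>t>0. y - x = t *\<^sub>R u)"
    then obtain w' :: "int ^ 'n" and t where u: "Gcd (range (\<lambda>i. w' $ i)) = 1"
        "u = (\<chi> i. of_int (w' $ i))" "t > 0" "y - x = t *\<^sub>R u"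
      unfolding primitive_vector_def by blast
    have "t * real_of_int (w' $ i) = real_of_int (z $ i)" for i
      using u z[of i] by (simp add: vec_eq_iff)
    then have "t = real_of_int g"
      using primitive_multiple_eq_Gcd[OF u(1,3)] by (simp add: g_def)
    then show "u = e" using u e g by simp
  qed
  moreover have "e \<noteq> 0" using e assms(3) by auto
  ultimately have "lattice_length x y = real_of_int g"
    using e g by (simp add: lattice_length_def)
  moreover have "e \<in> int_lattice" by (simp add: int_lattice_def e_def)
  ultimately show ?thesis using that e by metis
qed

section \<open>Polytopes with long edges\<close>

lemma segment_exit_rel_frontier:
  fixes P :: "'a::euclidean_space set"
  assumes "compact P" "u \<in> P" "u + l \<in> affine hull P" "0 \<le> K" "u + K *\<^sub>R l \<notin> P"
  obtains a where "0 \<le> a" "a \<le> K" "u + a *\<^sub>R l \<in> rel_frontier P"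
proof (cases "u \<in> rel_interior P")
  case True
  have "l \<noteq> 0" using assms by auto
  then obtain a where a: "0 < a" "u + a *\<^sub>R l \<in> rel_frontier P"
      "\<And>b. \<lbrakk>0 \<le> b; b < a\<rbrakk> \<Longrightarrow> u + b *\<^sub>R l \<in> rel_interior P"
    using ray_to_rel_frontier[OF compact_imp_bounded[OF assms(1)] True assms(3)] by metis
  have "\<not> K < a" using a(3)[of K] assms rel_interior_subset by blast
  then show ?thesis using a that[of a] by simp
next
  case False
  then have "u + 0 *\<^sub>R l \<in> rel_frontier P"
    using assms closure_subset by (auto simp: rel_frontier_def)
  then show ?thesis using that[of 0] assms by simp
qed

lemma lattice_polytope_face:
  assumes "lattice_polytope P" "F face_of P"
  shows "lattice_polytope F"
  using assms face_of_polytope_polytope extreme_point_of_face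
  unfolding lattice_polytope_def by blast

lemma long_edges_split:
  fixes P :: "(real ^ 'n) set"
  assumes "lattice_polytope P" "aff_dim P = int d"
    and edges: "\<And>x y. closed_segment x y edge_of P \<Longrightarrow> \<exists>e\<in>int_lattice. \<exists>l\<ge>L. y - x = l *\<^sub>R e"
    and "0 \<le> \<beta>" "\<beta> \<le> 1" and \<beta>: "2 * real d * (real d + 1) * (real d + 2) \<le> 3 * \<beta>\<^sup>2 * L"
    and "u \<in> P"
  shows "\<exists>y \<in> P \<inter> int_lattice. \<exists>x \<in> P. (1 + \<beta>) *\<^sub>R u = y + \<beta> *\<^sub>R x"
  using assms
proof (induction d arbitrary: P \<beta> u)
  case 0
  then obtain p where p: "P = {p}" by (auto simp: aff_dim_eq_0)
  then have "p \<in> int_lattice" using 0(1) by (auto simp: lattice_polytope_def)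
  then show ?case using p \<open>u \<in> P\<close> by (auto simp: algebra_simps)
next
  case (Suc n)
  define d where "d = Suc n"
  have d: "aff_dim P = int d" "0 < d" using Suc.prems by (auto simp: d_def)
  have poly: "polytope P" using Suc.prems by (simp add: lattice_polytope_def)
  then have conv: "convex P" and comp: "compact P"
    by (simp_all add: polytope_imp_convex polytope_imp_compact)
  have \<beta>d: "2 * real d * (real d + 1) * (real d + 2) \<le> 3 * \<beta>\<^sup>2 * L"
    using Suc.prems by (simp add: d_def)
  have "0 < 2 * real d * (real d + 1) * (real d + 2)" using d by simp
  then have "0 < \<beta>\<^sup>2 * L" using \<beta>d by linarith
  then have pos: "0 < \<beta>" "0 < L"
    using \<open>0 \<le> \<beta>\<close> by (auto simp: zero_less_mult_iff)
  have "2 * real d * (real d + 1) * 3 \<le> 2 * real d * (real d + 1) * (real d + 2)"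
    using d by (intro mult_left_mono) auto
  then have \<beta>2: "2 * real d * (real d + 1) \<le> \<beta>\<^sup>2 * L"
    using \<beta>d by linarith
  define K where "K = real d / (2 * \<beta>)"
  define s where "s = L / (real d + 1)"
  have s: "0 < s" using pos by (simp add: s_def)
  have K: "0 \<le> K" using pos by (simp add: K_def)
  have "\<beta>\<^sup>2 * L \<le> \<beta> * L"
    using pos \<open>\<beta> \<le> 1\<close> by (simp add: power2_eq_square mult_left_le)
  moreover have "0 \<le> real d * (real d + 1)" by simp
  ultimately have "real d * (real d + 1) \<le> 2 * \<beta> * L" using \<beta>2 by linarith
  then have Ks: "K \<le> s"
    using pos by (simp add: K_def s_def field_simps)
  obtain v q t where vq: "v extreme_point_of P" "q \<in> P" "1 / (real d + 1) \<le> t" "t \<le> 1"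
      "u = t *\<^sub>R v + (1 - t) *\<^sub>R q"
    using polytope_vertex_weight[OF poly d(1) \<open>u \<in> P\<close>] by metis
  have vP: "v \<in> P" using vq by (simp add: extreme_point_of_def)
  have vlat: "v \<in> int_lattice" using vq Suc.prems by (auto simp: lattice_polytope_def)
  define N where "N = {w - v | w. closed_segment v w edge_of P}"
  have "\<forall>b\<in>N. \<exists>e l. e \<in> int_lattice \<and> L \<le> l \<and> b = l *\<^sub>R e \<and> v + b \<in> P"
  proof
    fix b assume "b \<in> N"
    then obtain w where w: "closed_segment v w edge_of P" "b = w - v" by (auto simp: N_def)
    then have "v + b \<in> P" using edge_of_imp_subset ends_in_segment(2) by fastforce
    then show "\<exists>e l. e \<in> int_lattice \<and> L \<le> l \<and> b = l *\<^sub>R e \<and> v + b \<in> P"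
      using Suc.prems(3)[OF w(1)] w(2) by blast
  qed
  then obtain e l where el: "\<And>b. b \<in> N \<Longrightarrow> e b \<in> int_lattice \<and> L \<le> l b \<and> b = l b *\<^sub>R e b \<and> v + b \<in> P"
    by metis
  then have elat: "\<And>b. b \<in> N \<Longrightarrow> e b \<in> int_lattice" and lL: "\<And>b. b \<in> N \<Longrightarrow> L \<le> l b"
    and el_eq: "\<And>b. b \<in> N \<Longrightarrow> b = l b *\<^sub>R e b" and NP: "\<And>b. b \<in> N \<Longrightarrow> v + b \<in> P"
    by blast+
  have plus: "u + r *\<^sub>R e b \<in> P" if "b \<in> N" "0 \<le> r" "r \<le> s" for b r
  proof -
    have l: "0 < l b" "L \<le> l b" using lL[OF that(1)] pos by auto
    have t: "0 < t" using vq(3) by (rule less_le_trans[rotated]) simp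
    define k where "k = r / (t * l b)"
    have "r \<le> L * (1 / (real d + 1))" using that by (simp add: s_def)
    also have "\<dots> \<le> l b * t" using l vq(3) pos by (intro mult_mono) auto
    finally have k: "0 \<le> k" "k \<le> 1"
      using that l t by (auto simp: k_def field_simps)
    have "(1 - k) *\<^sub>R v + k *\<^sub>R (v + b) \<in> P"
      using k vP NP[OF that(1)] by (intro convexD[OF conv]) auto
    then have "t *\<^sub>R ((1 - k) *\<^sub>R v + k *\<^sub>R (v + b)) + (1 - t) *\<^sub>R q \<in> P"
      using vq t by (intro convexD[OF conv, of _ q]) auto
    moreover have "t *\<^sub>R ((1 - k) *\<^sub>R v + k *\<^sub>R (v + b)) + (1 - t) *\<^sub>R q = u + (t * k) *\<^sub>R b"
      by (simp add: vq(5) algebra_simps)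
    moreover have "(t * k) *\<^sub>R b = r *\<^sub>R e b"
    proof -
      have "(t * k) *\<^sub>R b = (t * k) *\<^sub>R (l b *\<^sub>R e b)"
        by (rule arg_cong[OF el_eq[OF that(1)]])
      also have "\<dots> = (t * k * l b) *\<^sub>R e b" by simp
      also have "t * k * l b = r" using t l by (simp add: k_def)
      finally show ?thesis .
    qed
    ultimately show ?thesis by simp
  qed
  obtain B where B: "B \<subseteq> N" "independent B" "N \<subseteq> span B"
    using maximal_independent_subset by blast
  have finB: "finite B" using B(2) by (rule independent_imp_finite)
  show ?case
  proof (cases "\<forall>b\<in>B. u - K *\<^sub>R e b \<in> P")
    case True
    have both: "u + r *\<^sub>R e b \<in> P" if "b \<in> B" "\<bar>r\<bar> \<le> K" for b r
    proof (cases "0 \<le> r")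
      case True
      then show ?thesis using plus[of b r] that B Ks by auto
    next
      case False
      then have Kr: "0 < K" "-r \<le> K" using that by auto
      have "(1 - (-r) / K) *\<^sub>R u + (-r / K) *\<^sub>R (u - K *\<^sub>R e b) \<in> P"
        using Kr False \<open>\<forall>b\<in>B. u - K *\<^sub>R e b \<in> P\<close> that \<open>u \<in> P\<close>
        by (intro convexD[OF conv]) (auto simp: field_simps)
      moreover have "(1 - (-r) / K) *\<^sub>R u + (-r / K) *\<^sub>R (u - K *\<^sub>R e b) = u + r *\<^sub>R e b"
        using Kr by (simp add: algebra_simps)
      ultimately show ?thesis by simp
    qed
    have "B \<subseteq> (\<lambda>x. x - v) ` P"
    proof
      fix b assume "b \<in> B"
      then have "v + b \<in> P" using NP B by blast
      then show "b \<in> (\<lambda>x. x - v) ` P" by (intro image_eqI[of _ _ "v + b"]) auto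
    qed
    then have "card B \<le> dim ((\<lambda>x. x - v) ` P)"
      using B(2) by (simp add: independent_card_le_dim)
    also have "\<dots> = d"
      using aff_dim_eq_dim_subtract[OF hull_inc[OF vP]] d by simp
    finally have cardB: "card B \<le> d" .
    have "u - v \<in> span N"
      using polytope_subset_span_edges[OF poly vq(1) \<open>u \<in> P\<close>] by (simp add: N_def)
    also have "span N \<subseteq> span B"
      using B(3) by (simp add: span_minimal subspace_span)
    finally obtain c where c: "u - v = (\<Sum>b\<in>B. c b *\<^sub>R b)"
      using span_finite[OF finB] by auto
    define \<epsilon> where "\<epsilon> b = real_of_int (round (c b * l b)) - c b * l b" for b
    define y where "y = u + (\<Sum>b\<in>B. \<epsilon> b *\<^sub>R e b)"
    have \<epsilon>: "\<bar>\<epsilon> b\<bar> \<le> 1 / 2" for b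
      unfolding \<epsilon>_def by (rule of_int_round_abs_le)
    have "u = v + (\<Sum>b\<in>B. (c b * l b) *\<^sub>R e b)"
    proof -
      have "(\<Sum>b\<in>B. c b *\<^sub>R b) = (\<Sum>b\<in>B. (c b * l b) *\<^sub>R e b)"
        using el_eq B(1) by (intro sum.cong refl) (metis scaleR_scaleR subsetD)
      then show ?thesis using c by (simp add: algebra_simps)
    qed
    then have "y = v + (\<Sum>b\<in>B. real_of_int (round (c b * l b)) *\<^sub>R e b)"
      by (simp add: y_def \<epsilon>_def scaleR_diff_left sum_subtractf)
    moreover have "\<dots> \<in> int_lattice"
      using elat B(1) vlat by (intro int_lattice_add int_lattice_sum int_lattice_scale_int) auto
    ultimately have "y \<in> int_lattice" by simp
    moreover have "y \<in> P"
      unfolding y_def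
    proof (rule convex_add_sum_mem[OF conv \<open>u \<in> P\<close> finB cardB d(2)])
      fix b assume b: "b \<in> B"
      have "\<bar>real d * \<epsilon> b\<bar> \<le> real d * (1 / 2)"
        using \<epsilon>[of b] unfolding abs_mult by (intro mult_mono) auto
      also have "\<dots> \<le> K"
        unfolding K_def using pos \<open>\<beta> \<le> 1\<close> by (simp add: field_simps mult_left_le_one_le)
      finally have "u + (real d * \<epsilon> b) *\<^sub>R e b \<in> P" by (rule both[OF b])
      then show "u + real d *\<^sub>R \<epsilon> b *\<^sub>R e b \<in> P" by simp
    qed
    moreover have "u + (\<Sum>b\<in>B. (- \<epsilon> b / \<beta>) *\<^sub>R e b) \<in> P"
    proof (rule convex_add_sum_mem[OF conv \<open>u \<in> P\<close> finB cardB d(2)])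
      fix b assume b: "b \<in> B"
      have "\<bar>real d * (- \<epsilon> b / \<beta>)\<bar> = (real d / \<beta>) * \<bar>\<epsilon> b\<bar>"
        using pos by (simp add: abs_mult)
      also have "\<dots> \<le> (real d / \<beta>) * (1 / 2)"
        using \<epsilon>[of b] pos by (intro mult_left_mono) auto
      also have "\<dots> = K" by (simp add: K_def)
      finally have "u + (real d * (- \<epsilon> b / \<beta>)) *\<^sub>R e b \<in> P"
        by (intro both[OF b]) simp
      then show "u + real d *\<^sub>R (- \<epsilon> b / \<beta>) *\<^sub>R e b \<in> P" by simp
    qed
    moreover have "(1 + \<beta>) *\<^sub>R u = y + \<beta> *\<^sub>R (u + (\<Sum>b\<in>B. (- \<epsilon> b / \<beta>) *\<^sub>R e b))"
    proof -
      have "\<beta> *\<^sub>R (\<Sum>b\<in>B. (- \<epsilon> b / \<beta>) *\<^sub>R e b) = - (\<Sum>b\<in>B. \<epsilon> b *\<^sub>R e b)"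
        using pos by (simp add: scaleR_sum_right sum_negf[symmetric])
      then show ?thesis by (simp add: y_def algebra_simps)
    qed
    ultimately show ?thesis by blast
  next
    case False
    then obtain b where b: "b \<in> N" "u + K *\<^sub>R (- e b) \<notin> P" using B by auto
    define q' where "q' = u + s *\<^sub>R e b"
    have q': "q' \<in> P" using plus[OF b(1), of s] s by (simp add: q'_def)
    have "(1 + 1 / s) *\<^sub>R u + (- 1 / s) *\<^sub>R q' \<in> affine hull P"
      using q' \<open>u \<in> P\<close> by (intro mem_affine[OF affine_affine_hull] hull_inc) auto
    moreover have "(1 + 1 / s) *\<^sub>R u + (- 1 / s) *\<^sub>R q' = u + (- e b)"
      using s by (simp add: q'_def algebra_simps)
    ultimately have "u + (- e b) \<in> affine hull P" by simp
    then obtain a where a: "0 \<le> a" "a \<le> K" "u + a *\<^sub>R (- e b) \<in> rel_frontier P"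
      using segment_exit_rel_frontier[OF comp \<open>u \<in> P\<close> _ K b(2)] by blast
    define u' where "u' = u - a *\<^sub>R e b"
    have "u' \<in> \<Union>{F. F facet_of P}"
      using a(3) rel_frontier_of_polyhedron[OF polytope_imp_polyhedron[OF poly]] by (simp add: u'_def)
    then obtain F where F: "F facet_of P" "u' \<in> F" by blast
    then have Fface: "F face_of P" "aff_dim F = int n"
      using d by (auto simp: facet_of_def d_def)
    have FP: "F \<subseteq> P" using F(1) by (rule facet_of_imp_subset)
    define \<tau> where "\<tau> = a / (a + s)"
    have \<tau>: "0 \<le> \<tau>" "\<tau> \<le> 1" using a s by (auto simp: \<tau>_def)
    have u: "u = (1 - \<tau>) *\<^sub>R u' + \<tau> *\<^sub>R q'"
    proof -
      have "\<tau> * s = (1 - \<tau>) * a" using a s by (simp add: \<tau>_def field_simps)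
      then have "\<tau> *\<^sub>R s *\<^sub>R e b = (1 - \<tau>) *\<^sub>R a *\<^sub>R e b" by simp
      then show ?thesis by (simp add: u'_def q'_def algebra_simps)
    qed
    define \<beta>' where "\<beta>' = \<beta> - \<tau> * (1 + \<beta>)"
    have "\<tau> \<le> a / s" unfolding \<tau>_def using a s by (intro divide_left_mono) auto
    also have "\<dots> \<le> K / s" using a s by (intro divide_right_mono) auto
    finally have \<tau>L: "2 * \<beta> * \<tau> * L \<le> real d * (real d + 1)"
      using pos by (simp add: K_def s_def field_simps)
    have "2 * \<beta> * (\<tau> * (1 + \<beta>)) * L = (2 * \<beta> * \<tau> * L) * (1 + \<beta>)" by (simp add: algebra_simps)
    also have "\<dots> \<le> (2 * \<beta> * \<tau> * L) * 2"
      using pos \<tau> \<open>\<beta> \<le> 1\<close> by (intro mult_left_mono) auto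
    also have "\<dots> \<le> 2 * real d * (real d + 1)" using \<tau>L by linarith
    finally have drop: "2 * \<beta> * (\<tau> * (1 + \<beta>)) * L \<le> 2 * real d * (real d + 1)" .
    also have "\<dots> \<le> \<beta>\<^sup>2 * L" by (rule \<beta>2)
    finally have "(\<beta> * L) * (2 * (\<tau> * (1 + \<beta>))) \<le> (\<beta> * L) * \<beta>"
      by (simp add: power2_eq_square mult_ac)
    then have "2 * (\<tau> * (1 + \<beta>)) \<le> \<beta>" using pos by (simp only: mult_le_cancel_left_pos mult_pos_pos)
    moreover have nn: "0 \<le> \<tau> * (1 + \<beta>)" using \<tau> pos by simp
    ultimately have \<beta>': "0 \<le> \<beta>'" "\<beta>' \<le> 1"
      using \<open>\<beta> \<le> 1\<close> unfolding \<beta>'_def by linarith+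
    \<comment> \<open>Passing to a facet costs at most \<open>2d(d + 1)/L\<close> in \<open>\<beta>\<^sup>2\<close>, which sums up over the
      dimensions to the bound assumed on \<open>\<beta>\<close>.\<close>
    have "(\<beta>\<^sup>2 - 2 * \<beta> * (\<tau> * (1 + \<beta>))) * L \<le> \<beta>'\<^sup>2 * L"
      using pos by (intro mult_right_mono) (auto simp: \<beta>'_def power2_diff)
    then have "\<beta>\<^sup>2 * L - 2 * real d * (real d + 1) \<le> \<beta>'\<^sup>2 * L"
      using drop by (simp add: left_diff_distrib)
    moreover have "2 * real n * (real n + 1) * (real n + 2)
        = 2 * real d * (real d + 1) * (real d + 2) - 3 * (2 * real d * (real d + 1))"
      by (simp add: d_def algebra_simps)
    ultimately have \<beta>'n: "2 * real n * (real n + 1) * (real n + 2) \<le> 3 * \<beta>'\<^sup>2 * L"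
      using \<beta>d by linarith
    have "\<exists>y \<in> F \<inter> int_lattice. \<exists>x \<in> F. (1 + \<beta>') *\<^sub>R u' = y + \<beta>' *\<^sub>R x"
      using Suc.IH[OF lattice_polytope_face[OF Suc.prems(1) Fface(1)] Fface(2) _ \<beta>' \<beta>'n F(2)]
        Suc.prems(3) edge_of_face[OF _ Fface(1)] by blast
    then obtain y x where yx: "y \<in> F" "y \<in> int_lattice" "x \<in> F" "(1 + \<beta>') *\<^sub>R u' = y + \<beta>' *\<^sub>R x"
      by blast
    define x' where "x' = (\<beta>' / \<beta>) *\<^sub>R x + ((1 + \<beta>) * \<tau> / \<beta>) *\<^sub>R q'"
    have "x' \<in> P"
      unfolding x'_def using yx FP q' \<beta>' pos \<tau>
      by (intro convexD[OF conv]) (auto simp: \<beta>'_def field_simps)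
    moreover have "(1 + \<beta>) *\<^sub>R u = y + \<beta> *\<^sub>R x'"
    proof -
      have "(1 + \<beta>) *\<^sub>R u = ((1 + \<beta>) * (1 - \<tau>)) *\<^sub>R u' + ((1 + \<beta>) * \<tau>) *\<^sub>R q'"
        by (subst u) (simp add: scaleR_add_right)
      also have "(1 + \<beta>) * (1 - \<tau>) = 1 + \<beta>'" by (simp add: \<beta>'_def algebra_simps)
      finally show ?thesis using yx(4) pos by (simp add: x'_def scaleR_add_right)
    qed
    ultimately show ?thesis using yx FP by blast
  qed
qed

section \<open>Simplices with long edges\<close>

lemma mem_zonotope_iff:
  fixes e :: "nat \<Rightarrow> 'a::real_vector"
  shows "x \<in> {p} + (\<Sum>i<k. closed_segment 0 (e i)) \<longleftrightarrow>
    (\<exists>s. (\<forall>i<k. 0 \<le> s i \<and> s i \<le> 1) \<and> x = p + (\<Sum>i<k. s i *\<^sub>R e i))"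
proof
  assume "x \<in> {p} + (\<Sum>i<k. closed_segment 0 (e i))"
  then obtain f where f: "\<forall>i<k. f i \<in> closed_segment 0 (e i)" "x = p + sum f {..<k}"
    by (auto simp: set_sum_alt elim!: set_plus_elim)
  then have "\<forall>i<k. \<exists>s. 0 \<le> s \<and> s \<le> 1 \<and> f i = s *\<^sub>R e i"
    by (auto simp: in_segment)
  then obtain s where s: "\<forall>i<k. 0 \<le> s i \<and> s i \<le> 1 \<and> f i = s i *\<^sub>R e i"
    by metis
  then have "sum f {..<k} = (\<Sum>i<k. s i *\<^sub>R e i)" by (intro sum.cong) auto
  with s f show "\<exists>s. (\<forall>i<k. 0 \<le> s i \<and> s i \<le> 1) \<and> x = p + (\<Sum>i<k. s i *\<^sub>R e i)"
    by auto
next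
  assume "\<exists>s. (\<forall>i<k. 0 \<le> s i \<and> s i \<le> 1) \<and> x = p + (\<Sum>i<k. s i *\<^sub>R e i)"
  then obtain s where s: "\<forall>i<k. 0 \<le> s i \<and> s i \<le> 1" "x = p + (\<Sum>i<k. s i *\<^sub>R e i)"
    by auto
  then have "\<forall>i\<in>{..<k}. s i *\<^sub>R e i \<in> closed_segment 0 (e i)"
    by (auto simp: in_segment)
  then have "(\<Sum>i<k. s i *\<^sub>R e i) \<in> (\<Sum>i<k. closed_segment 0 (e i))"
    unfolding set_sum_alt[OF finite_lessThan] by blast
  then show "x \<in> {p} + (\<Sum>i<k. closed_segment 0 (e i))"
    using s by (auto intro: set_plus_intro)
qed

lemma lattice_parallelepiped_zonotope:
  fixes e :: "nat \<Rightarrow> real ^ 'n"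
  assumes "p \<in> int_lattice" "\<And>i. i < k \<Longrightarrow> e i \<in> int_lattice"
    and "inj_on e {..<k}" "independent (e ` {..<k})"
  shows "lattice_parallelepiped ({p} + (\<Sum>i<k. closed_segment 0 (e i)))"
proof -
  let ?Q = "{p} + (\<Sum>i<k. closed_segment 0 (e i))"
  have "parallelepiped ?Q"
    unfolding parallelepiped_def using assms(3,4)
    by (intro exI[of _ k] exI[of _ p] exI[of _ "\<lambda>_. 0"] exI[of _ e]) simp
  moreover have "?Q = convex hull ({p} + (\<Sum>i<k. {0, e i}))"
    by (simp add: convex_hull_set_plus convex_hull_set_sum segment_convex_hull)
  then have "{v. v extreme_point_of ?Q} \<subseteq> {p} + (\<Sum>i<k. {0, e i})"
    using extreme_point_of_convex_hull by auto
  moreover have "{p} + (\<Sum>i<k. {0, e i}) \<subseteq> int_lattice"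
  proof
    fix x assume "x \<in> {p} + (\<Sum>i<k. {0, e i})"
    then obtain f where f: "\<forall>i<k. f i \<in> {0, e i}" "x = p + sum f {..<k}"
      by (auto simp: set_sum_alt elim!: set_plus_elim)
    then show "x \<in> int_lattice"
      using assms(1,2) int_lattice_zero
      by (auto intro!: int_lattice_add int_lattice_sum)
  qed
  ultimately show ?thesis unfolding lattice_parallelepiped_def by blast
qed

lemma convex_add_sum_diff_mem:
  fixes P :: "'a::real_vector set" and w :: "nat \<Rightarrow> 'a"
  assumes "convex P" "v \<in> P" "\<And>i. i < k \<Longrightarrow> w i \<in> P" "\<And>i. i < k \<Longrightarrow> 0 \<le> \<nu> i" "(\<Sum>i<k. \<nu> i) \<le> 1"
  shows "v + (\<Sum>i<k. \<nu> i *\<^sub>R (w i - v)) \<in> P"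
proof -
  define c where "c i = (if i < k then \<nu> i else 1 - (\<Sum>i<k. \<nu> i))" for i
  define z where "z i = (if i < k then w i else v)" for i
  have "(\<Sum>i\<in>{..<Suc k}. c i *\<^sub>R z i) \<in> P"
    using assms by (intro convex_sum) (auto simp: c_def z_def)
  moreover have "(\<Sum>i\<in>{..<Suc k}. c i *\<^sub>R z i) = v + (\<Sum>i<k. \<nu> i *\<^sub>R (w i - v))"
    by (simp add: c_def z_def scaleR_diff_right sum_subtractf scaleR_sum_left algebra_simps)
  ultimately show ?thesis by simp
qed

lemma independent_rescale_family:
  fixes f e :: "'b \<Rightarrow> 'a::real_vector"
  assumes "finite I" "inj_on f I" "independent (f ` I)"
    and f: "\<And>i. i \<in> I \<Longrightarrow> f i = l i *\<^sub>R e i" and l: "\<And>i. i \<in> I \<Longrightarrow> l i \<noteq> 0"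
  shows "inj_on e I" "independent (e ` I)"
proof -
  have zero: "c i = 0" if "(\<Sum>i\<in>I. c i *\<^sub>R e i) = 0" "i \<in> I" for c i
  proof -
    have "(\<Sum>x\<in>f ` I. (c (inv_into I f x) / l (inv_into I f x)) *\<^sub>R x)
        = (\<Sum>i\<in>I. (c i / l i) *\<^sub>R f i)"
      using assms(2) by (subst sum.reindex) auto
    also have "\<dots> = (\<Sum>i\<in>I. c i *\<^sub>R e i)"
      using f l by (intro sum.cong) auto
    finally have "c (inv_into I f (f i)) / l (inv_into I f (f i)) = 0"
      using assms that
      by (intro independentD[OF assms(3) _ order_refl, of "\<lambda>x. c (inv_into I f x) / l (inv_into I f x)"]) auto
    then show ?thesis using assms(2) that(2) l by simp
  qed
  show inj: "inj_on e I"
  proof (rule inj_onI, rule ccontr)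
    fix i j assume ij: "i \<in> I" "j \<in> I" "e i = e j" "i \<noteq> j"
    let ?c = "\<lambda>k. (if k = i then 1 else 0) - (if k = j then 1 else (0::real))"
    have "(\<Sum>k\<in>I. ?c k *\<^sub>R e k) = (\<Sum>k\<in>I. (if k = i then e k else 0)) - (\<Sum>k\<in>I. (if k = j then e k else 0))"
      unfolding sum_subtractf[symmetric] by (intro sum.cong) auto
    also have "\<dots> = 0" using ij assms(1) by simp
    finally have "?c i = 0" by (rule zero[OF _ ij(1)])
    then show False using ij by simp
  qed
  show "independent (e ` I)"
  proof (rule independent_if_scalars_zero)
    fix c x assume c: "(\<Sum>x\<in>e ` I. c x *\<^sub>R x) = 0" "x \<in> e ` I"
    then have "(\<Sum>i\<in>I. c (e i) *\<^sub>R e i) = 0" using inj by (simp add: sum.reindex)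
    then show "c x = 0" using zero[of "\<lambda>i. c (e i)"] c(2) by blast
  qed (use assms in auto)
qed

lemma simplex_vertex_edge:
  assumes "\<not> affine_dependent C" "v \<in> C" "w \<in> C" "v \<noteq> w"
  shows "closed_segment v w edge_of (convex hull C)"
proof -
  have "\<exists>c\<subseteq>C. convex hull {v, w} = convex hull c"
    using assms(2,3) by (intro exI[of _ "{v, w}"]) auto
  then have "convex hull {v, w} face_of convex hull C"
    using face_of_convex_hull_affine_independent[OF assms(1)] by blast
  moreover have "aff_dim (convex hull {v, w}) = 1"
    using assms(4) by (simp add: aff_dim_convex_hull aff_dim_2)
  ultimately show ?thesis
    unfolding edge_of_def segment_convex_hull ..
qed

lemma long_simplex_parallelepiped:
  fixes P :: "(real ^ 'n) set"
  assumes simplex: "int d simplex P" and lat: "{v. v extreme_point_of P} \<subseteq> int_lattice"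
    and edges: "\<And>x y. closed_segment x y edge_of P \<Longrightarrow>
      \<exists>e\<in>int_lattice. \<exists>l \<ge> real d * (real d + 1). y - x = l *\<^sub>R e"
    and "u \<in> P"
  obtains p and e :: "nat \<Rightarrow> real ^ 'n" where "p \<in> int_lattice" "\<And>i. i < d \<Longrightarrow> e i \<in> int_lattice"
    "inj_on e {..<d}" "independent (e ` {..<d})"
    "{p} + (\<Sum>i<d. closed_segment 0 (e i)) \<subseteq> P" "u \<in> {p} + (\<Sum>i<d. closed_segment 0 (e i))"
proof -
  obtain C where C: "\<not> affine_dependent C" "card C = d + 1" "P = convex hull C"
    using simplex unfolding simplex_def by auto
  have finC: "finite C" using C(1) by (rule aff_independent_finite)
  obtain \<kappa> where \<kappa>: "\<forall>c\<in>C. 0 \<le> \<kappa> c" "sum \<kappa> C = 1" "(\<Sum>c\<in>C. \<kappa> c *\<^sub>R c) = u"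
    using \<open>u \<in> P\<close> unfolding C(3) convex_hull_finite[OF finC] by auto
  have "\<exists>v\<in>C. 1 / (real d + 1) \<le> \<kappa> v"
  proof (rule ccontr)
    assume "\<not> ?thesis"
    then have "sum \<kappa> C < (\<Sum>c\<in>C. 1 / (real d + 1))"
      using C(2) finC by (intro sum_strict_mono) auto
    also have "\<dots> = 1" using C(2) by (simp add: field_simps)
    finally show False using \<kappa>(2) by simp
  qed
  then obtain v where v: "v \<in> C" "1 / (real d + 1) \<le> \<kappa> v" by blast
  have "card (C - {v}) = d" using v C(2) by simp
  then obtain w where w: "bij_betw w {..<d} (C - {v})"
    using ex_bij_betw_nat_finite[of "C - {v}"] finC by (auto simp: atLeast0LessThan)
  have wC: "w i \<in> C" "w i \<noteq> v" if "i < d" for i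
    using w that bij_betwE by fastforce+
  have CP: "C \<subseteq> P" using C(3) hull_subset by metis
  have "\<forall>i\<in>{..<d}. \<exists>e l. e \<in> int_lattice \<and> real d * (real d + 1) \<le> l \<and> w i - v = l *\<^sub>R e"
  proof
    fix i assume "i \<in> {..<d}"
    then have "closed_segment v (w i) edge_of P"
      using simplex_vertex_edge[OF C(1) v(1)] wC[of i] C(3) by fastforce
    then show "\<exists>e l. e \<in> int_lattice \<and> real d * (real d + 1) \<le> l \<and> w i - v = l *\<^sub>R e"
      using edges by blast
  qed
  then obtain e l where el: "\<And>i. i < d \<Longrightarrow> e i \<in> int_lattice"
      "\<And>i. i < d \<Longrightarrow> real d * (real d + 1) \<le> l i" "\<And>i. i < d \<Longrightarrow> w i - v = l i *\<^sub>R e i"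
    by (metis lessThan_iff)
  have lpos: "0 < l i" if "i < d" for i
  proof -
    have "0 < real d * (real d + 1)" using that by simp
    then show ?thesis using el(2)[OF that] by linarith
  qed
  have "v extreme_point_of P"
    using C v extreme_point_of_convex_hull_affine_independent by blast
  then have vlat: "v \<in> int_lattice" using lat by blast
  have "(\<lambda>i. w i - v) ` {..<d} = (\<lambda>x. - v + x) ` (C - {v})"
    unfolding bij_betw_imp_surj_on[OF w, symmetric] by (simp add: image_image)
  then have ind: "independent ((\<lambda>i. w i - v) ` {..<d})"
    using affine_dependent_iff_dependent2[OF v(1)] C(1) by simp
  have inj: "inj_on (\<lambda>i. w i - v) {..<d}"
    using bij_betw_imp_inj_on[OF w] by (auto simp: inj_on_def)
  have le: "w i - v = l i *\<^sub>R e i" "l i \<noteq> 0" if "i \<in> {..<d}" for i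
    using that el(3) lpos[of i] by auto
  have e_ind: "inj_on e {..<d}" "independent (e ` {..<d})"
    using independent_rescale_family[OF finite_lessThan inj ind le] by blast+
  have sum\<kappa>: "\<kappa> v + (\<Sum>i<d. \<kappa> (w i)) = 1"
    using \<kappa>(2) v finC sum.reindex_bij_betw[OF w, of \<kappa>] by (simp add: sum.remove)
  have "u = \<kappa> v *\<^sub>R v + (\<Sum>i<d. \<kappa> (w i) *\<^sub>R w i)"
    using \<kappa>(3) v finC sum.reindex_bij_betw[OF w, of "\<lambda>c. \<kappa> c *\<^sub>R c"] by (simp add: sum.remove)
  also have "\<dots> = (\<kappa> v + (\<Sum>i<d. \<kappa> (w i))) *\<^sub>R v + (\<Sum>i<d. \<kappa> (w i) *\<^sub>R (w i - v))"
    by (simp add: scaleR_diff_right sum_subtractf scaleR_sum_left algebra_simps)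
  also have "\<dots> = v + (\<Sum>i<d. (\<kappa> (w i) * l i) *\<^sub>R e i)"
    using sum\<kappa> el(3) by simp
  finally have u: "u = v + (\<Sum>i<d. (\<kappa> (w i) * l i) *\<^sub>R e i)" .
  define p where "p = v + (\<Sum>i<d. real_of_int \<lfloor>\<kappa> (w i) * l i\<rfloor> *\<^sub>R e i)"
  let ?Q = "{p} + (\<Sum>i<d. closed_segment 0 (e i))"
  have "p \<in> int_lattice"
    unfolding p_def using vlat el(1) by (intro int_lattice_add int_lattice_sum int_lattice_scale_int) auto
  moreover have "u \<in> ?Q"
    unfolding mem_zonotope_iff
  proof (intro exI conjI allI impI)
    show "u = p + (\<Sum>i<d. frac (\<kappa> (w i) * l i) *\<^sub>R e i)"
      by (simp add: u p_def frac_def scaleR_diff_left sum_subtractf)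
  qed (auto simp: frac_lt_1 less_imp_le)
  moreover have "?Q \<subseteq> P"
  proof
    fix x assume "x \<in> ?Q"
    then obtain s where s: "\<forall>i<d. 0 \<le> s i \<and> s i \<le> 1" "x = p + (\<Sum>i<d. s i *\<^sub>R e i)"
      unfolding mem_zonotope_iff by blast
    define \<nu> where "\<nu> i = (real_of_int \<lfloor>\<kappa> (w i) * l i\<rfloor> + s i) / l i" for i
    have "x = v + (\<Sum>i<d. (real_of_int \<lfloor>\<kappa> (w i) * l i\<rfloor> + s i) *\<^sub>R e i)"
      by (simp add: s p_def scaleR_add_left sum.distrib)
    also have "(\<Sum>i<d. (real_of_int \<lfloor>\<kappa> (w i) * l i\<rfloor> + s i) *\<^sub>R e i) = (\<Sum>i<d. \<nu> i *\<^sub>R (w i - v))"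
    proof (rule sum.cong[OF refl])
      fix i assume "i \<in> {..<d}"
      then show "(real_of_int \<lfloor>\<kappa> (w i) * l i\<rfloor> + s i) *\<^sub>R e i = \<nu> i *\<^sub>R (w i - v)"
        using lpos[of i] el(3)[of i] by (simp add: \<nu>_def)
    qed
    finally have x: "x = v + (\<Sum>i<d. \<nu> i *\<^sub>R (w i - v))" .
    have \<nu>0: "0 \<le> \<nu> i" if "i < d" for i
      unfolding \<nu>_def using lpos[OF that] \<kappa>(1) wC[OF that] s(1) that by simp
    have "\<nu> i \<le> \<kappa> (w i) + 1 / (real d * (real d + 1))" if "i < d" for i
    proof -
      have "\<nu> i \<le> (\<kappa> (w i) * l i + 1) / l i"
        unfolding \<nu>_def using s(1) that lpos[OF that]
        by (intro divide_right_mono add_mono) auto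
      also have "\<dots> = \<kappa> (w i) + 1 / l i" using lpos[OF that] by (simp add: field_simps)
      also have "1 / l i \<le> 1 / (real d * (real d + 1))"
        using el(2)[OF that] that by (intro divide_left_mono mult_pos_pos lpos) auto
      finally show ?thesis by simp
    qed
    then have "(\<Sum>i<d. \<nu> i) \<le> (\<Sum>i<d. \<kappa> (w i) + 1 / (real d * (real d + 1)))"
      by (intro sum_mono) auto
    also have "\<dots> \<le> (\<Sum>i<d. \<kappa> (w i)) + 1 / (real d + 1)"
      by (simp add: sum.distrib)
    also have "\<dots> \<le> 1" using sum\<kappa> v(2) by linarith
    finally have "(\<Sum>i<d. \<nu> i) \<le> 1" .
    then show "x \<in> P"
      unfolding x using \<nu>0 wC CP v(1) C(3)
      by (intro convex_add_sum_diff_mem) auto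
  qed
  ultimately show ?thesis using that el(1) e_ind by blast
qed

lemma zonotope_lattice_split:
  fixes e :: "nat \<Rightarrow> real ^ 'n"
  assumes "p \<in> int_lattice" "\<And>i. i < k \<Longrightarrow> e i \<in> int_lattice"
    and "u \<in> {p} + (\<Sum>i<k. closed_segment 0 (e i))" (is "u \<in> ?Q")
  shows "\<exists>y \<in> ?Q \<inter> int_lattice. 2 *\<^sub>R u - y \<in> ?Q"
proof -
  obtain s where s: "\<forall>i<k. 0 \<le> s i \<and> s i \<le> 1" "u = p + (\<Sum>i<k. s i *\<^sub>R e i)"
    using assms(3) unfolding mem_zonotope_iff by blast
  define r :: "nat \<Rightarrow> int" where "r i = (if s i \<le> 1 / 2 then 0 else 1)" for i
  define y where "y = p + (\<Sum>i<k. real_of_int (r i) *\<^sub>R e i)"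
  have "y \<in> int_lattice"
    unfolding y_def using assms by (intro int_lattice_add int_lattice_sum int_lattice_scale_int) auto
  moreover have "y \<in> ?Q"
    unfolding mem_zonotope_iff y_def
    by (intro exI[of _ "\<lambda>i. real_of_int (r i)"]) (auto simp: r_def)
  moreover have "2 *\<^sub>R u - y \<in> ?Q"
    unfolding mem_zonotope_iff
  proof (intro exI[of _ "\<lambda>i. 2 * s i - real_of_int (r i)"] conjI)
    show "\<forall>i<k. 0 \<le> 2 * s i - real_of_int (r i) \<and> 2 * s i - real_of_int (r i) \<le> 1"
      using s(1) by (auto simp: r_def)
    show "2 *\<^sub>R u - y = p + (\<Sum>i<k. (2 * s i - real_of_int (r i)) *\<^sub>R e i)"
      by (simp add: s(2) y_def scaleR_diff_left sum_subtractf scaleR_add_right scaleR_sum_right scaleR_2)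
  qed
  ultimately show ?thesis by blast
qed

lemma lattice_length_edge:
  fixes P :: "(real ^ 'n) set"
  assumes "lattice_polytope P" "closed_segment x y edge_of P"
  obtains e where "e \<in> int_lattice" "y - x = lattice_length x y *\<^sub>R e"
proof -
  have "x \<in> int_lattice" "y \<in> int_lattice"
    using assms edge_endpoint_extreme_point unfolding lattice_polytope_def by blast+
  moreover have "x \<noteq> y" using assms(2) by (auto simp: edge_of_def)
  ultimately show ?thesis using lattice_length_scaleR that by blast
qed

theorem theorem1p3:
  fixes P :: "(real ^ 'n) set" and d :: nat
  assumes "lattice_polytope P" and "aff_dim P = int d"
  shows "((\<forall>x y. closed_segment x y edge_of P \<longrightarrow>
              lattice_length x y \<ge> real (2 * d\<^sup>2 * (d + 1)))
            \<longrightarrow> integrally_closed P)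
       \<and> (int d simplex P \<and>
            (\<forall>x y. closed_segment x y edge_of P \<longrightarrow>
              lattice_length x y \<ge> real (d * (d + 1)))
            \<longrightarrow> P = \<Union>{Q. lattice_parallelepiped Q \<and> Q \<subseteq> P} \<and> integrally_closed P)"
proof (intro conjI impI; (elim conjE)?)
  have conv: "convex P" using assms(1) by (simp add: lattice_polytope_def polytope_imp_convex)
  {
    assume len: "\<forall>x y. closed_segment x y edge_of P \<longrightarrow>
      lattice_length x y \<ge> real (2 * d\<^sup>2 * (d + 1))"
    define L where "L = real (2 * d\<^sup>2 * (d + 1))"
    have edges: "\<exists>e\<in>int_lattice. \<exists>l\<ge>L. y - x = l *\<^sub>R e" if "closed_segment x y edge_of P" for x y
      using lattice_length_edge[OF assms(1) that] len that unfolding L_def by metis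
    have "real d * (real d + 1) * (real d + 2) \<le> real d * (real d + 1) * (3 * real d)"
      by (cases "d = 0") (auto intro!: mult_left_mono)
    then have "2 * real d * (real d + 1) * (real d + 2) \<le> 3 * 1\<^sup>2 * L"
      by (simp add: L_def power2_eq_square algebra_simps)
    then have "\<exists>y \<in> P \<inter> int_lattice. \<exists>x \<in> P. (1 + 1) *\<^sub>R u = y + 1 *\<^sub>R x" if "u \<in> P" for u
      using long_edges_split[OF assms edges, of 1 u] that by auto
    then have "\<exists>y \<in> P \<inter> int_lattice. 2 *\<^sub>R u - y \<in> P" if "u \<in> P" for u
      using that by (metis add_diff_cancel_left' one_add_one scaleR_one)
    then show "integrally_closed P" by (intro integrally_closedI conv)
  }
  {
    assume simplex: "int d simplex P" and len: "\<forall>x y. closed_segment x y edge_of P \<longrightarrow>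
      lattice_length x y \<ge> real (d * (d + 1))"
    have edges: "\<exists>e\<in>int_lattice. \<exists>l\<ge>real d * (real d + 1). y - x = l *\<^sub>R e"
      if edge: "closed_segment x y edge_of P" for x y
    proof -
      obtain e where "e \<in> int_lattice" "y - x = lattice_length x y *\<^sub>R e"
        using lattice_length_edge[OF assms(1) edge] by metis
      moreover have "real d * (real d + 1) \<le> lattice_length x y"
        using len edge by (simp add: algebra_simps)
      ultimately show ?thesis by blast
    qed
    have lat: "{v. v extreme_point_of P} \<subseteq> int_lattice"
      using assms(1) by (simp add: lattice_polytope_def)
    show "P = \<Union>{Q. lattice_parallelepiped Q \<and> Q \<subseteq> P}"
    proof
      show "P \<subseteq> \<Union>{Q. lattice_parallelepiped Q \<and> Q \<subseteq> P}"
      proof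
        fix u assume "u \<in> P"
        with long_simplex_parallelepiped[OF simplex lat edges] obtain p and e :: "nat \<Rightarrow> real ^ 'n"
          where "p \<in> int_lattice" "\<And>i. i < d \<Longrightarrow> e i \<in> int_lattice"
            "inj_on e {..<d}" "independent (e ` {..<d})"
            and Q: "{p} + (\<Sum>i<d. closed_segment 0 (e i)) \<subseteq> P"
              "u \<in> {p} + (\<Sum>i<d. closed_segment 0 (e i))"
          by metis
        then have "lattice_parallelepiped ({p} + (\<Sum>i<d. closed_segment 0 (e i)))"
          by (intro lattice_parallelepiped_zonotope)
        with Q show "u \<in> \<Union>{Q. lattice_parallelepiped Q \<and> Q \<subseteq> P}" by blast
      qed
    qed blast
    show "integrally_closed P"
    proof (rule integrally_closedI[OF conv])
      fix u assume "u \<in> P"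
      with long_simplex_parallelepiped[OF simplex lat edges] obtain p and e :: "nat \<Rightarrow> real ^ 'n"
        where pe: "p \<in> int_lattice" "\<And>i. i < d \<Longrightarrow> e i \<in> int_lattice"
          and Q: "{p} + (\<Sum>i<d. closed_segment 0 (e i)) \<subseteq> P"
            "u \<in> {p} + (\<Sum>i<d. closed_segment 0 (e i))"
        by metis
      show "\<exists>y \<in> P \<inter> int_lattice. 2 *\<^sub>R u - y \<in> P"
        using zonotope_lattice_split[OF pe Q(2)] Q(1) by blast
    qed
  }
qed

end
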